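(* Let $(\mathcal{F}_n)_{n\ge0}$ be a filtration, and let $(\tau_m)_{m\ge0}$ be a strictly increasing sequence of almost surely finite stopping times with respect to $(\mathcal{F}_n)_{n\ge0}$, with $\tau_0=0$. Put $\mathcal{G}_m:=\mathcal{F}_{\tau_m}$ for $m\ge0$ and $L_m:=\tau_m-\tau_{m-1}$ for $m\ge1$, and assume $\sup_{m\ge1}\mathbb{E}[L_m^2]<\infty$. Let $(B_n,R_n,X_n)_{n\ge1}$ be a sequence of wagers with uniformly bounded random variables (not necessarily adapted to $(\mathcal{F}_n)_{n\ge0}$). Assume that there exist constants $\rho',\rho''$ such that $$\rho'\le\frac{\mathbb{E}[R_n\mid\mathcal{F}_{n-1}]}{\mathbb{E}[B_n\mid\mathcal{F}_{n-1}]}\le\rho''\quad\text{a.s. for all } n\ge1,$$ or equivalently (with $\chi'=\rho'-1$ and $\chi''=\rho''-1$) constants $\chi',\chi''$ such that $$\chi'\le\frac{\mathbb{E}[X_n\mid\mathcal{F}_{n-1}]}{\mathbb{E}[B_n\mid\mathcal{F}_{n-1}]}\le\chi''\quad\text{a.s. for all } n\ge1.$$ Define, for $m\ge1$, $$\overline{B}_m:=\sum_{i=\tau_{m-1}+1}^{\tau_m}B_i,\qquad \overline{R}_m:=\sum_{i=\tau_{m-1}+1}^{\tau_m}R_i,\qquad \overline{X}_m:=\sum_{i=\tau_{m-1}+1}^{\tau_m}X_i.$$ Assume further that $\overline{B}_m,\overline{R}_m,\overline{X}_m$ are $\mathcal{G}_m$-measurable for each $m\ge1$ and that $$\liminf_{m\to\infty}\frac1m\sum_{j=1}^m\overline{B}_j>0\quad\text{a.s.}$$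 Then, writing $$\overline{\mathfrak{R}}_m:=\frac{\sum_{j=1}^m\overline{R}_j}{\sum_{j=1}^m\overline{B}_j},\qquad \overline{\mathfrak{X}}_m:=\frac{\sum_{j=1}^m\overline{X}_j}{\sum_{j=1}^m\overline{B}_j},$$ we have $$\rho'\le\liminf_{m\to\infty}\overline{\mathfrak{R}}_m\le\limsup_{m\to\infty}\overline{\mathfrak{R}}_m\le\rho''\quad\text{a.s.}\qquad\text{and}\qquad \chi'\le\liminf_{m\to\infty}\overline{\mathfrak{X}}_m\le\limsup_{m\to\infty}\overline{\mathfrak{X}}_m\le\chi''\quad\text{a.s.}$$ In particular, if $\rho'=\rho''=\rho$, or equivalently $\chi'=\chi''=\chi$, then $\lim_{m\to\infty}\overline{\mathfrak{R}}_m=\rho$ a.s. and $\lim_{m\to\infty}\overline{\mathfrak{X}}_m=\chi$ a.s.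
   Context: All random variables live on a common probability space. A wager is a triple $(B,R,X)$ of real random variables (bet, return, profit) with $B\ge0$, $R\ge0$, $X=R-B$, and $R=X=0$ whenever $B=0$. "Uniformly bounded" means there is a constant bounding $B_n$, $R_n$, $|X_n|$ for all $n$. The index $n$ counts spins or rolls, and the $m$th round consists of the spins or rolls $\tau_{m-1}+1,\dots,\tau_m$; $\mathcal{F}_{\tau_m}$ is the usual stopped $\sigma$-algebra. The two-sided inequalities on ratios of conditional expectations are regarded as satisfied wherever the ratio is of the form $0/0$. The ratios $\overline{\mathfrak{R}}_m$, $\overline{\mathfrak{X}}_m$ are considered for $m$ large enough that the denominator is positive (which holds eventually, almost surely). *)

theory Defs
  imports "HOL-Probability.Probability"
begin

text \<open>A wager (bet, return, profit).  Relations between random variables are read almost surely.\<close>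

definition wager :: "'a measure \<Rightarrow> ('a \<Rightarrow> real) \<Rightarrow> ('a \<Rightarrow> real) \<Rightarrow> ('a \<Rightarrow> real) \<Rightarrow> bool" where
  "wager M B R X \<longleftrightarrow>
     B \<in> borel_measurable M \<and> R \<in> borel_measurable M \<and> X \<in> borel_measurable M \<and>
     (AE \<omega> in M. B \<omega> \<ge> 0 \<and> R \<omega> \<ge> 0 \<and> X \<omega> = R \<omega> - B \<omega> \<and>
        (B \<omega> = 0 \<longrightarrow> R \<omega> = 0 \<and> X \<omega> = 0))"

definition uniformly_bounded_wagers ::
  "'a measure \<Rightarrow> (nat \<Rightarrow> 'a \<Rightarrow> real) \<Rightarrow> (nat \<Rightarrow> 'a \<Rightarrow> real) \<Rightarrow> (nat \<Rightarrow> 'a \<Rightarrow> real) \<Rightarrow> bool" where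
  "uniformly_bounded_wagers M B R X \<longleftrightarrow>
     (\<exists>C. \<forall>n\<ge>1. AE \<omega> in M. B n \<omega> \<le> C \<and> R n \<omega> \<le> C \<and> \<bar>X n \<omega>\<bar> \<le> C)"

text \<open>
  Stopping times that are only almost surely finite take values in \<^typ>\<open>enat\<close>, whereas the
  library predicate \<^const>\<open>stopping_time\<close> and the stopped sigma-algebra
  \<open>filtration.pre_sigma\<close> index the filtration by the values of the stopping time.  With the
  ambient sigma-algebra added at \<open>\<infinity>\<close> they become the usual notions: \<open>{T \<le> n} \<in> F n\<close> for
  all natural \<open>n\<close>, and the events \<open>A\<close> of \<open>M\<close> with \<open>A \<inter> {T \<le> n} \<in> F n\<close> for all natural \<open>n\<close>.
\<close>

definition extend_filtration :: "'a measure \<Rightarrow> (nat \<Rightarrow> 'a measure) \<Rightarrow> enat \<Rightarrow> 'a measure" where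
  "extend_filtration M F t = (case t of enat n \<Rightarrow> F n | \<infinity> \<Rightarrow> M)"

definition stopped_algebra ::
  "'a measure \<Rightarrow> (nat \<Rightarrow> 'a measure) \<Rightarrow> ('a \<Rightarrow> enat) \<Rightarrow> 'a measure" where
  "stopped_algebra M F T = filtration.pre_sigma (space M) (extend_filtration M F) T"

text \<open>
  Bounds on a ratio, regarded as satisfied when it has the form \<open>0/0\<close>; a ratio with nonzero
  numerator and zero denominator does not satisfy them (recall \<open>x / 0 = 0\<close> in HOL).
\<close>

definition ratio_within :: "real \<Rightarrow> real \<Rightarrow> real \<Rightarrow> real \<Rightarrow> bool" where
  "ratio_within lo hi p q \<longleftrightarrow>
     (p = 0 \<and> q = 0) \<or> (q \<noteq> 0 \<and> lo \<le> p / q \<and> p / q \<le> hi)"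

definition cond_ratio_within ::
  "'a measure \<Rightarrow> (nat \<Rightarrow> 'a measure) \<Rightarrow> real \<Rightarrow> real \<Rightarrow>
   (nat \<Rightarrow> 'a \<Rightarrow> real) \<Rightarrow> (nat \<Rightarrow> 'a \<Rightarrow> real) \<Rightarrow> bool" where
  "cond_ratio_within M F lo hi Y B \<longleftrightarrow>
     (\<forall>n\<ge>1. AE \<omega> in M. ratio_within lo hi
        (real_cond_exp M (F (n - 1)) (Y n) \<omega>) (real_cond_exp M (F (n - 1)) (B n) \<omega>))"

text \<open>
  The total over the \<open>m\<close>th round (\<open>m \<ge> 1\<close>).  It is \<open>0\<close> on the null event \<open>\<tau> m = \<infinity>\<close>; since
  the stopped sigma-algebra contains every event of \<open>M\<close> inside \<open>{\<tau> m = \<infinity>}\<close>, this convention does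
  not affect measurability.
\<close>

definition round_sum :: "(nat \<Rightarrow> 'a \<Rightarrow> enat) \<Rightarrow> (nat \<Rightarrow> 'a \<Rightarrow> real) \<Rightarrow> nat \<Rightarrow> 'a \<Rightarrow> real" where
  "round_sum \<tau> Y m \<omega> = (\<Sum>i | \<tau> (m - 1) \<omega> < enat i \<and> enat i \<le> \<tau> m \<omega>. Y i \<omega>)"

text \<open>
  The value is \<open>0\<close> where the denominator vanishes; under the hypotheses of the theorem this concerns,
  almost surely, only finitely many \<open>m\<close> and hence no limit.
\<close>

definition round_ratio ::
  "(nat \<Rightarrow> 'a \<Rightarrow> enat) \<Rightarrow> (nat \<Rightarrow> 'a \<Rightarrow> real) \<Rightarrow> (nat \<Rightarrow> 'a \<Rightarrow> real) \<Rightarrow> nat \<Rightarrow> 'a \<Rightarrow> real" where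
  "round_ratio \<tau> Y B m \<omega> =
     (\<Sum>j=1..m. round_sum \<tau> Y j \<omega>) / (\<Sum>j=1..m. round_sum \<tau> B j \<omega>)"

end

theory Submission
  imports Defs "HOL-Library.Discrete_Functions"
begin

text \<open>
  Put $Y_n = R_n - \rho' B_n$ (or $\rho'' B_n - R_n$).  Whether spin $n$ belongs to round $m$ is
  decided by time $n - 1$, so the round totals of $Y$ have nonnegative conditional expectation given
  the previous rounds.  Subtracting these conditional expectations leaves an orthogonal sequence that
  is bounded in $L^2$ because the round lengths are, so the strong law of large numbers applies to it
  and the averages of the round totals of $Y$ have nonnegative lower limit.  Dividing by the averages
  of the round totals of $B$, which stay away from zero, gives the bounds on the ratios.
\<close>

section \<open>Strong laws of large numbers\<close>

text \<open>Only round totals are measurable for the stopped algebras, hence orthogonality is sought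
  between rounds. Conditional expectations given a stopped algebra are never computed; their sign is
  read off from integrals over events A of the past. Such an A, cut down to the outcomes for which
  spin i lies in the round, belongs to \<open>F (i - 1)\<close>, where the hypothesis on spin i
  applies directly. Rounds have no bounded length. The length, integrable because its square is,
  dominates the sum over the spins of a round; its second moment, times a constant, bounds that of
  the round total uniformly in the round. The ratio hypothesis enters only as linear inequalities,
  after clearing a nonnegative denominator.\<close>

lemma AE_tendsto_zero_of_summable_integral:
  fixes f :: "nat \<Rightarrow> 'a \<Rightarrow> real"
  assumes int: "\<And>k. integrable M (f k)" and nonneg: "\<And>k x. 0 \<le> f k x"
    and le: "\<And>k. (\<integral>x. f k x \<partial>M) \<le> c k" and c: "summable c"
  shows "AE x in M. (\<lambda>k. f k x) \<longlonglongrightarrow> 0"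
proof -
  have c0: "0 \<le> c k" for k
    using le[of k] Bochner_Integration.integral_nonneg[of M "f k"] nonneg by (metis order_trans)
  \<comment> \<open>Interchanging sum and integral does the work of Chebyshev and Borel-Cantelli: a
    series with finite integral converges almost everywhere, so its terms vanish in the
    limit.\<close>
  have "(\<integral>\<^sup>+x. (\<Sum>k. ennreal (f k x)) \<partial>M) = (\<Sum>k. \<integral>\<^sup>+x. ennreal (f k x) \<partial>M)"
    using int by (intro nn_integral_suminf) auto
  also have "\<dots> \<le> (\<Sum>k. ennreal (c k))"
    using int nonneg le by (intro suminf_le) (auto simp: nn_integral_eq_integral ennreal_leI)
  also have "\<dots> < \<infinity>"
    using c c0 by (simp add: suminf_ennreal2 less_top[symmetric])
  finally have "(\<integral>\<^sup>+x. (\<Sum>k. ennreal (f k x)) \<partial>M) \<noteq> \<infinity>" by simp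
  then have "AE x in M. (\<Sum>k. ennreal (f k x)) \<noteq> \<infinity>"
    using int by (intro nn_integral_PInf_AE) auto
  then show ?thesis
  proof eventually_elim
    case (elim x)
    then have "summable (\<lambda>k. f k x)"
      using nonneg by (intro summable_suminf_not_top) auto
    then show ?case by (rule summable_LIMSEQ_zero)
  qed
qed

lemma integrable_mult_of_squares:
  fixes f g :: "'a \<Rightarrow> real"
  assumes "f \<in> borel_measurable M" "g \<in> borel_measurable M"
    and "integrable M (\<lambda>x. (f x)\<^sup>2)" "integrable M (\<lambda>x. (g x)\<^sup>2)"
  shows "integrable M (\<lambda>x. f x * g x)"
proof (rule Bochner_Integration.integrable_bound)
  show "integrable M (\<lambda>x. (f x)\<^sup>2 + (g x)\<^sup>2)" using assms by simp
  have "\<bar>a * b\<bar> \<le> a\<^sup>2 + b\<^sup>2" for a b :: real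
  proof -
    have "2 * (\<bar>a\<bar> * \<bar>b\<bar>) \<le> a\<^sup>2 + b\<^sup>2"
      using sum_squares_bound[of "\<bar>a\<bar>" "\<bar>b\<bar>"] by (simp add: mult.assoc)
    then show ?thesis by (simp add: abs_mult) (use mult_nonneg_nonneg[of "\<bar>a\<bar>" "\<bar>b\<bar>"] in linarith)
  qed
  then show "AE x in M. norm (f x * g x) \<le> norm ((f x)\<^sup>2 + (g x)\<^sup>2)"
    by (intro AE_I2) simp
qed (use assms in measurable)

lemma integral_square_sum_orthogonal_le:
  fixes Z :: "nat \<Rightarrow> 'a \<Rightarrow> real"
  assumes fin: "finite A"
    and meas: "\<And>j. j \<in> A \<Longrightarrow> Z j \<in> borel_measurable M"
    and int: "\<And>j. j \<in> A \<Longrightarrow> integrable M (\<lambda>x. (Z j x)\<^sup>2)"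
    and le: "\<And>j. j \<in> A \<Longrightarrow> (\<integral>x. (Z j x)\<^sup>2 \<partial>M) \<le> K"
    and orth: "\<And>i j. i \<in> A \<Longrightarrow> j \<in> A \<Longrightarrow> i < j \<Longrightarrow> (\<integral>x. Z i x * Z j x \<partial>M) = 0"
  shows "integrable M (\<lambda>x. (\<Sum>j\<in>A. Z j x)\<^sup>2)"
    and "(\<integral>x. (\<Sum>j\<in>A. Z j x)\<^sup>2 \<partial>M) \<le> K * card A"
proof -
  have prod: "integrable M (\<lambda>x. Z i x * Z j x)" if "i \<in> A" "j \<in> A" for i j
    using that meas int by (intro integrable_mult_of_squares) auto
  have sq: "(\<Sum>j\<in>A. Z j x)\<^sup>2 = (\<Sum>i\<in>A. \<Sum>j\<in>A. Z i x * Z j x)" for x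
    by (simp add: power2_eq_square sum_product)
  show "integrable M (\<lambda>x. (\<Sum>j\<in>A. Z j x)\<^sup>2)"
    unfolding sq using prod by auto
  have "(\<integral>x. (\<Sum>j\<in>A. Z j x)\<^sup>2 \<partial>M) = (\<Sum>i\<in>A. \<Sum>j\<in>A. \<integral>x. Z i x * Z j x \<partial>M)"
    unfolding sq using prod by (simp add: Bochner_Integration.integral_sum)
  also have "\<dots> = (\<Sum>i\<in>A. \<Sum>j\<in>A. if i = j then \<integral>x. (Z i x)\<^sup>2 \<partial>M else 0)"
  proof (intro sum.cong refl)
    fix i j assume "i \<in> A" "j \<in> A"
    then show "(\<integral>x. Z i x * Z j x \<partial>M) = (if i = j then \<integral>x. (Z i x)\<^sup>2 \<partial>M else 0)"
      using orth[of i j] orth[of j i] by (cases i j rule: linorder_cases) (auto simp: power2_eq_square mult.commute)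
  qed
  also have "\<dots> = (\<Sum>i\<in>A. \<integral>x. (Z i x)\<^sup>2 \<partial>M)"
    using fin by simp
  also have "\<dots> \<le> K * card A"
    using sum_bounded_above[of A "\<lambda>i. \<integral>x. (Z i x)\<^sup>2 \<partial>M" K] le by (simp add: mult.commute)
  finally show "(\<integral>x. (\<Sum>j\<in>A. Z j x)\<^sup>2 \<partial>M) \<le> K * card A" .
qed

text \<open>Absolute values destroy orthogonality, so Cauchy-Schwarz costs a factor
  \<open>card A\<close> compared with the orthogonal case. That is affordable for blocks of about 2k
  terms when the normalization is k^2.\<close>

lemma integral_square_sum_abs_le:
  fixes Z :: "nat \<Rightarrow> 'a \<Rightarrow> real"
  assumes meas: "\<And>j. j \<in> A \<Longrightarrow> Z j \<in> borel_measurable M"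
    and int: "\<And>j. j \<in> A \<Longrightarrow> integrable M (\<lambda>x. (Z j x)\<^sup>2)"
    and le: "\<And>j. j \<in> A \<Longrightarrow> (\<integral>x. (Z j x)\<^sup>2 \<partial>M) \<le> K"
  shows "integrable M (\<lambda>x. (\<Sum>j\<in>A. \<bar>Z j x\<bar>)\<^sup>2)"
    and "(\<integral>x. (\<Sum>j\<in>A. \<bar>Z j x\<bar>)\<^sup>2 \<partial>M) \<le> K * (card A)\<^sup>2"
proof -
  have cs: "(\<Sum>j\<in>A. \<bar>Z j x\<bar>)\<^sup>2 \<le> card A * (\<Sum>j\<in>A. (Z j x)\<^sup>2)" for x
    using Cauchy_Schwarz_ineq_sum[of "\<lambda>_. 1" "\<lambda>j. \<bar>Z j x\<bar>" A] by simp
  have int': "integrable M (\<lambda>x. card A * (\<Sum>j\<in>A. (Z j x)\<^sup>2))"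
    using int by simp
  show 1: "integrable M (\<lambda>x. (\<Sum>j\<in>A. \<bar>Z j x\<bar>)\<^sup>2)"
    by (rule Bochner_Integration.integrable_bound[OF int'])
      (use meas cs in \<open>auto simp: abs_mult sum_nonneg\<close>)
  have "(\<integral>x. (\<Sum>j\<in>A. \<bar>Z j x\<bar>)\<^sup>2 \<partial>M) \<le> (\<integral>x. card A * (\<Sum>j\<in>A. (Z j x)\<^sup>2) \<partial>M)"
    using 1 int' cs by (rule integral_mono)
  also have "\<dots> = card A * (\<Sum>j\<in>A. \<integral>x. (Z j x)\<^sup>2 \<partial>M)"
    using int by (simp add: Bochner_Integration.integral_sum)
  also have "\<dots> \<le> card A * (card A * K)"
    using sum_bounded_above[of A "\<lambda>i. \<integral>x. (Z i x)\<^sup>2 \<partial>M" K] le by (intro mult_left_mono) auto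
  finally show "(\<integral>x. (\<Sum>j\<in>A. \<bar>Z j x\<bar>)\<^sup>2 \<partial>M) \<le> K * (card A)\<^sup>2"
    by (simp add: power2_eq_square algebra_simps)
qed

lemma filterlim_floor_sqrt: "filterlim floor_sqrt at_top sequentially"
  unfolding filterlim_at_top
proof
  fix k :: nat
  show "\<forall>\<^sub>F n in sequentially. k \<le> floor_sqrt n"
    using eventually_ge_at_top[of "k\<^sup>2"]
    by eventually_elim (metis floor_sqrt_inverse_power2 mono_floor_sqrt')
qed

text \<open>Convergence along the squares follows from the variance bound; between consecutive squares
  the sum of at most $2k + 1$ terms is controlled by Cauchy-Schwarz, so no maximal inequality is
  needed.\<close>

lemma strong_law_orthogonal:
  fixes Z :: "nat \<Rightarrow> 'a \<Rightarrow> real"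
  assumes meas: "\<And>j. j \<ge> 1 \<Longrightarrow> Z j \<in> borel_measurable M"
    and int: "\<And>j. j \<ge> 1 \<Longrightarrow> integrable M (\<lambda>x. (Z j x)\<^sup>2)"
    and le: "\<And>j. j \<ge> 1 \<Longrightarrow> (\<integral>x. (Z j x)\<^sup>2 \<partial>M) \<le> K"
    and orth: "\<And>i j. 1 \<le> i \<Longrightarrow> i < j \<Longrightarrow> (\<integral>x. Z i x * Z j x \<partial>M) = 0"
  shows "AE x in M. (\<lambda>n. (\<Sum>j=1..n. Z j x) / n) \<longlonglongrightarrow> 0"
proof -
  define S where "S n x = (\<Sum>j=1..n. Z j x)" for n x
  define V where "V k x = (\<Sum>j\<in>{k\<^sup>2<..(Suc k)\<^sup>2}. \<bar>Z j x\<bar>)" for k x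
  have K: "0 \<le> K"
    by (rule order_trans[OF _ le[of 1]]) simp_all
  \<comment> \<open>Two majorants. The second moment of the sum up to k^2 is at most K k^2, which
    over k^4 gives K / k^2. For the block after k^2, (2k + 1)^2 \<le> (3k)^2 for k \<ge> 1 gives 9 K
    / k^2. At k = 0 both sides are 0, since division by 0 gives 0.\<close>
  have "summable (\<lambda>k. K * (1 / (real k)\<^sup>2))" "summable (\<lambda>k. 9 * K * (1 / (real k)\<^sup>2))"
    using inverse_power_summable[of 2, where 'a=real]
    by (intro summable_mult; simp add: inverse_eq_divide power_divide)+
  note summ = this
  have "AE x in M. (\<lambda>k. (S (k\<^sup>2) x / (real k)\<^sup>2)\<^sup>2) \<longlonglongrightarrow> 0"
  proof (rule AE_tendsto_zero_of_summable_integral[OF _ _ _ summ(1)])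
    fix k
    have *: "integrable M (\<lambda>x. (S (k\<^sup>2) x)\<^sup>2)" "(\<integral>x. (S (k\<^sup>2) x)\<^sup>2 \<partial>M) \<le> K * real (k\<^sup>2)"
      using integral_square_sum_orthogonal_le[of "{1..k\<^sup>2}" Z M K] meas int le orth
      by (auto simp: S_def)
    then show "integrable M (\<lambda>x. (S (k\<^sup>2) x / (real k)\<^sup>2)\<^sup>2)"
      by (simp add: power_divide)
    show "(\<integral>x. (S (k\<^sup>2) x / (real k)\<^sup>2)\<^sup>2 \<partial>M) \<le> K * (1 / (real k)\<^sup>2)"
      using *(2) by (cases "k = 0") (simp_all add: power_divide field_simps power2_eq_square)
  qed simp
  moreover have "AE x in M. (\<lambda>k. (V k x / (real k)\<^sup>2)\<^sup>2) \<longlonglongrightarrow> 0"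
  proof (rule AE_tendsto_zero_of_summable_integral[OF _ _ _ summ(2)])
    fix k :: nat
    have "card {k\<^sup>2<..(Suc k)\<^sup>2} = 2 * k + 1"
      by (simp add: power2_eq_square)
    then have *: "integrable M (\<lambda>x. (V k x)\<^sup>2)" "(\<integral>x. (V k x)\<^sup>2 \<partial>M) \<le> K * (real (2 * k + 1))\<^sup>2"
      using integral_square_sum_abs_le[of "{k\<^sup>2<..(Suc k)\<^sup>2}" Z M K] meas int le
      by (auto simp: V_def)
    then show "integrable M (\<lambda>x. (V k x / (real k)\<^sup>2)\<^sup>2)"
      by (simp add: power_divide)
    show "(\<integral>x. (V k x / (real k)\<^sup>2)\<^sup>2 \<partial>M) \<le> 9 * K * (1 / (real k)\<^sup>2)"
    proof (cases "k = 0")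
      case False
      have "(\<integral>x. (V k x)\<^sup>2 \<partial>M) \<le> K * (3 * real k)\<^sup>2"
        using *(2) mult_left_mono[OF power_mono[of "real (2 * k + 1)" "3 * real k" 2] K] False
        by simp
      then show ?thesis
        using False by (simp add: power_divide field_simps power2_eq_square)
    qed simp
  qed simp
  ultimately show ?thesis
  proof eventually_elim
    case (elim x)
    \<comment> \<open>Square roots turn the limits of the squares into limits of absolute values;
      composing with \<open>floor_sqrt\<close> then moves them from the index k to all n.\<close>
    have "(\<lambda>k. \<bar>S (k\<^sup>2) x / (real k)\<^sup>2\<bar> + \<bar>V k x / (real k)\<^sup>2\<bar>) \<longlonglongrightarrow> 0"
      using tendsto_add_zero[OF tendsto_real_sqrt[OF elim(1), unfolded real_sqrt_abs real_sqrt_zero]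
          tendsto_real_sqrt[OF elim(2), unfolded real_sqrt_abs real_sqrt_zero]] .
    from filterlim_compose[OF this filterlim_floor_sqrt]
    have lim: "(\<lambda>n. \<bar>S ((floor_sqrt n)\<^sup>2) x / (real (floor_sqrt n))\<^sup>2\<bar>
        + \<bar>V (floor_sqrt n) x / (real (floor_sqrt n))\<^sup>2\<bar>) \<longlonglongrightarrow> 0" .
    show ?case
    proof (rule Lim_null_comparison[OF _ lim])
      show "\<forall>\<^sub>F n in sequentially. norm ((\<Sum>j=1..n. Z j x) / n)
          \<le> \<bar>S ((floor_sqrt n)\<^sup>2) x / (real (floor_sqrt n))\<^sup>2\<bar>
            + \<bar>V (floor_sqrt n) x / (real (floor_sqrt n))\<^sup>2\<bar>"
        using eventually_ge_at_top[of 1]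
      proof eventually_elim
        case (elim n)
        define k where "k = floor_sqrt n"
        have k: "k\<^sup>2 \<le> n" "n < (Suc k)\<^sup>2" "0 < k"
          using elim Suc_floor_sqrt_power2_gt[of n] by (auto simp: k_def)
        have "{1..n} = {1..k\<^sup>2} \<union> {k\<^sup>2<..n}"
          using k by auto
        then have "S n x = S (k\<^sup>2) x + (\<Sum>j\<in>{k\<^sup>2<..n}. Z j x)"
          unfolding S_def by (simp only:) (rule sum.union_disjoint, auto)
        moreover have "\<bar>\<Sum>j\<in>{k\<^sup>2<..n}. Z j x\<bar> \<le> V k x"
          unfolding V_def using k by (intro order_trans[OF sum_abs] sum_mono2) auto
        ultimately have "\<bar>S n x\<bar> \<le> \<bar>S (k\<^sup>2) x\<bar> + \<bar>V k x\<bar>"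
          by linarith
        then have "\<bar>S n x\<bar> / n \<le> (\<bar>S (k\<^sup>2) x\<bar> + \<bar>V k x\<bar>) / real (k\<^sup>2)"
          using k by (intro frac_le) (auto simp del: of_nat_power)
        then show ?case
          by (simp add: S_def k_def add_divide_distrib)
      qed
    qed
  qed
qed

text \<open>The sums of \<open>W\<close> exceed those of the orthogonal \<open>Z\<close> by sums of
  \<open>C\<close>, which are nonnegative almost surely, and the sums of \<open>Z\<close> are o(m).
  The sign condition is stated on events of \<open>H (m - 1)\<close>, the form in which stopping
  times deliver it.\<close>

lemma strong_law_conditionally_nonneg:
  fixes W :: "nat \<Rightarrow> 'a \<Rightarrow> real"
  assumes M: "prob_space M"
    and sub: "\<And>m. subalgebra M (H m)"
    and mono: "\<And>m n. m \<le> n \<Longrightarrow> subalgebra (H n) (H m)"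
    and adapted: "\<And>m. m \<ge> 1 \<Longrightarrow> W m \<in> borel_measurable (H m)"
    and int: "\<And>m. m \<ge> 1 \<Longrightarrow> integrable M (\<lambda>x. (W m x)\<^sup>2)"
    and le: "\<And>m. m \<ge> 1 \<Longrightarrow> (\<integral>x. (W m x)\<^sup>2 \<partial>M) \<le> K"
    and nonneg: "\<And>m A. m \<ge> 1 \<Longrightarrow> A \<in> sets (H (m - 1)) \<Longrightarrow> 0 \<le> (\<integral>x\<in>A. W m x \<partial>M)"
  shows "AE x in M. \<forall>e>0. \<forall>\<^sub>F m in sequentially. - e * real m \<le> (\<Sum>j=1..m. W j x)"
proof -
  interpret prob_space M by fact
  define C where "C m = real_cond_exp M (H (m - 1)) (W m)" for m
  define Z where "Z m x = W m x - C m x" for m x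
  have sf: "sigma_finite_subalgebra M (H m)" for m
    using sub by (intro finite_measure_subalgebra_is_sigma_finite)
      (simp add: finite_measure_subalgebra_def finite_measure_subalgebra_axioms_def finite_measure_axioms)
  have W[measurable]: "W m \<in> borel_measurable M" if "m \<ge> 1" for m
    using measurable_from_subalg[OF sub adapted[OF that]] .
  have C[measurable]: "C m \<in> borel_measurable M" for m
    unfolding C_def by measurable
  have intW: "integrable M (W m)" if "m \<ge> 1" for m
    using square_integrable_imp_integrable[OF W[OF that] int[OF that]] .
  \<comment> \<open>Conditional Jensen for the square: conditioning does not increase second
    moments, so the same \<open>K\<close> serves.\<close>
  have C2: "integrable M (\<lambda>x. (C m x)\<^sup>2)" "(\<integral>x. (C m x)\<^sup>2 \<partial>M) \<le> K" if m: "m \<ge> 1" for m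
  proof -
    interpret sigma_finite_subalgebra M "H (m - 1)" by (rule sf)
    have conv: "convex_on UNIV (\<lambda>x::real. x\<^sup>2)"
      using convex_power_even[of 2] by simp
    show i: "integrable M (\<lambda>x. (C m x)\<^sup>2)"
      unfolding C_def using intW[OF m] int[OF m] conv
      by (intro integrable_convex_cond_exp[where I=UNIV and q="\<lambda>x. x\<^sup>2"]) auto
    have "AE x in M. (C m x)\<^sup>2 \<le> real_cond_exp M (H (m - 1)) (\<lambda>x. (W m x)\<^sup>2) x"
      unfolding C_def using intW[OF m] int[OF m] conv
      by (intro real_cond_exp_jensens_inequality(2)[where I=UNIV and q="\<lambda>x. x\<^sup>2"]) auto
    then have "(\<integral>x. (C m x)\<^sup>2 \<partial>M) \<le> (\<integral>x. real_cond_exp M (H (m - 1)) (\<lambda>x. (W m x)\<^sup>2) x \<partial>M)"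
      using i real_cond_exp_int(1)[OF int[OF m]] by (intro integral_mono_AE)
    also have "\<dots> \<le> K"
      using real_cond_exp_int(2)[OF int[OF m]] le[OF m] by simp
    finally show "(\<integral>x. (C m x)\<^sup>2 \<partial>M) \<le> K" .
  qed
  \<comment> \<open>Test against the event where \<open>C m\<close> is negative. It lies in
    \<open>H (m - 1)\<close>, so there the integral of \<open>C m\<close> equals that of
    \<open>W m\<close> and is nonnegative, while the integrand is nonpositive; hence the event is
    null.\<close>
  have C_nonneg: "AE x in M. 0 \<le> C m x" if m: "m \<ge> 1" for m
  proof -
    interpret sigma_finite_subalgebra M "H (m - 1)" by (rule sf)
    define A where "A = {x \<in> space M. C m x < 0}"
    have "C m \<in> borel_measurable (H (m - 1))" unfolding C_def by measurable
    then have "{x \<in> space (H (m - 1)). C m x < 0} \<in> sets (H (m - 1))" by measurable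
    then have A: "A \<in> sets (H (m - 1))"
      using sub[of "m - 1"] by (simp add: A_def subalgebra_def)
    then have AM[measurable]: "A \<in> sets M" using sub[of "m - 1"] by (auto simp: subalgebra_def)
    have iC: "integrable M (C m)"
      unfolding C_def using intW[OF m] by (rule real_cond_exp_int)
    have *: "integrable M (\<lambda>x. - (indicator A x * C m x))"
      using integrable_mult_indicator[OF AM iC] by simp
    have "0 \<le> (\<integral>x. indicator A x * C m x \<partial>M)"
      using nonneg[OF m A] real_cond_exp_intA[OF intW[OF m] A]
      by (simp add: C_def set_lebesgue_integral_def)
    moreover have "0 \<le> (\<integral>x. - (indicator A x * C m x) \<partial>M)"
      by (intro Bochner_Integration.integral_nonneg) (auto simp: A_def indicator_def)
    ultimately have "(\<integral>x. - (indicator A x * C m x) \<partial>M) = 0" by simp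
    then have "AE x in M. - (indicator A x * C m x) = 0"
      using * by (subst (asm) integral_nonneg_eq_0_iff_AE) (auto simp: A_def indicator_def)
    then show ?thesis
      by (rule AE_mp) (auto simp: A_def indicator_def intro!: AE_I2)
  qed
  have "AE x in M. (\<lambda>n. (\<Sum>j=1..n. Z j x) / n) \<longlonglongrightarrow> 0"
  proof (rule strong_law_orthogonal)
    fix j :: nat assume j: "j \<ge> 1"
    show [measurable]: "Z j \<in> borel_measurable M"
      unfolding Z_def using j by measurable
    \<comment> \<open>From (a - c)^2 \<le> 2 a^2 + 2 c^2; with the bound \<open>K\<close> for both
      terms this is where \<open>4 * K\<close> comes from.\<close>
    have bd: "(Z j x)\<^sup>2 \<le> 2 * (W j x)\<^sup>2 + 2 * (C j x)\<^sup>2" for x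
      unfolding Z_def using sum_squares_bound[of "W j x" "- C j x"]
      by (simp add: power2_diff)
    have i: "integrable M (\<lambda>x. 2 * (W j x)\<^sup>2 + 2 * (C j x)\<^sup>2)"
      using int[OF j] C2[OF j] by simp
    show iz: "integrable M (\<lambda>x. (Z j x)\<^sup>2)"
      by (rule Bochner_Integration.integrable_bound[OF i]) (use bd in auto)
    have "(\<integral>x. (Z j x)\<^sup>2 \<partial>M) \<le> (\<integral>x. 2 * (W j x)\<^sup>2 + 2 * (C j x)\<^sup>2 \<partial>M)"
      using iz i bd by (rule integral_mono)
    also have "\<dots> \<le> 4 * K"
      using int[OF j] C2[OF j] le[OF j] by simp
    finally show "(\<integral>x. (Z j x)\<^sup>2 \<partial>M) \<le> 4 * K" .
  next
    fix i j :: nat assume ij: "1 \<le> i" "i < j"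
    interpret sigma_finite_subalgebra M "H (j - 1)" by (rule sf)
    \<comment> \<open>Since i \<le> j - 1, the factor \<open>Z i\<close> is known at stage j - 1 and
      can be pulled out of the conditional expectation of \<open>W j\<close>; this gives the
      orthogonality.\<close>
    have Zi: "Z i \<in> borel_measurable (H (j - 1))"
    proof -
      have "C i \<in> borel_measurable (H i)"
        unfolding C_def by (rule measurable_from_subalg[OF mono[of "i - 1"]]) auto
      then have "Z i \<in> borel_measurable (H i)"
        unfolding Z_def using adapted[OF ij(1)] by measurable
      then show ?thesis using ij by (intro measurable_from_subalg[OF mono[of i "j - 1"]]) auto
    qed
    have ZiM: "Z i \<in> borel_measurable M" by (rule measurable_from_subalg[OF sub Zi])
    have bd: "(Z i x)\<^sup>2 \<le> 2 * (W i x)\<^sup>2 + 2 * (C i x)\<^sup>2" for x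
      unfolding Z_def using sum_squares_bound[of "W i x" "- C i x"]
      by (simp add: power2_diff)
    have "integrable M (\<lambda>x. 2 * (W i x)\<^sup>2 + 2 * (C i x)\<^sup>2)"
      using int[OF ij(1)] C2[OF ij(1)] by simp
    then have iz: "integrable M (\<lambda>x. (Z i x)\<^sup>2)"
      by (rule Bochner_Integration.integrable_bound) (use bd ZiM in auto)
    have ZW: "integrable M (\<lambda>x. Z i x * W j x)" "integrable M (\<lambda>x. Z i x * C j x)"
      using ij ZiM W C iz int C2(1) by (auto intro!: integrable_mult_of_squares)
    have "(\<integral>x. Z i x * C j x \<partial>M) = (\<integral>x. Z i x * W j x \<partial>M)"
      unfolding C_def using ZW(1) Zi W ij by (intro real_cond_exp_intg(2)) auto
    moreover have "(\<integral>x. Z i x * Z j x \<partial>M) = (\<integral>x. Z i x * W j x \<partial>M) - (\<integral>x. Z i x * C j x \<partial>M)"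
      using ZW by (simp add: Z_def[of j] right_diff_distrib)
    ultimately show "(\<integral>x. Z i x * Z j x \<partial>M) = 0" by simp
  qed
  moreover have "AE x in M. \<forall>m. m \<ge> 1 \<longrightarrow> 0 \<le> C m x"
    using C_nonneg by (simp add: AE_all_countable)
  ultimately show ?thesis
  proof eventually_elim
    case (elim x)
    show ?case
    proof (intro allI impI)
      fix e :: real assume "0 < e"
      then have "\<forall>\<^sub>F n in sequentially. - e < (\<Sum>j=1..n. Z j x) / n"
        using elim(1) by (intro order_tendstoD) auto
      then show "\<forall>\<^sub>F m in sequentially. - e * real m \<le> (\<Sum>j=1..m. W j x)"
        using eventually_gt_at_top[of 0]
      proof eventually_elim
        case (elim m)
        then have "- e * real m \<le> (\<Sum>j=1..m. Z j x)" by (simp add: field_simps)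
        also have "\<dots> \<le> (\<Sum>j=1..m. W j x)"
          using \<open>\<forall>m. m \<ge> 1 \<longrightarrow> 0 \<le> C m x\<close> by (intro sum_mono) (simp add: Z_def)
        finally show ?case .
      qed
    qed
  qed
qed

section \<open>Stopping times and rounds\<close>

locale discrete_filtered_space = prob_space M for M :: "'a measure" +
  fixes F :: "nat \<Rightarrow> 'a measure"
  assumes filtration_F: "filtration (space M) F"
    and subalgebra_F: "\<And>n. subalgebra M (F n)"
begin

lemma filtration_extend: "filtration (space M) (extend_filtration M F)"
proof
  show "space (extend_filtration M F i) = space M" for i
    using filtration.space_F[OF filtration_F] by (cases i) (auto simp: extend_filtration_def)
  show "sets (extend_filtration M F i) \<subseteq> sets (extend_filtration M F j)" if "i \<le> j" for i j
    using that filtration.sets_F_mono[OF filtration_F] subalgebra_F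
    by (cases i; cases j) (auto simp: extend_filtration_def subalgebra_def)
qed

lemma sets_extend_subset: "sets (extend_filtration M F t) \<subseteq> sets M"
  using subalgebra_F by (cases t) (auto simp: extend_filtration_def subalgebra_def)

lemma space_extend: "space (extend_filtration M F t) = space M"
  using filtration.space_F[OF filtration_extend] .

lemma sigma_finite_subalgebra_F: "sigma_finite_subalgebra M (F n)"
  using subalgebra_F by (intro finite_measure_subalgebra_is_sigma_finite)
    (simp add: finite_measure_subalgebra_def finite_measure_subalgebra_axioms_def finite_measure_axioms)

lemma subalgebra_stopped_algebra:
  assumes T: "stopping_time (extend_filtration M F) T"
  shows "subalgebra M (stopped_algebra M F T)"
proof -
  \<comment> \<open>At time \<infinity> the cut {T \<le> \<infinity>} removes nothing and the
    extended filtration is \<open>M\<close> itself.\<close>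
  have "A \<in> sets M" if "A \<in> sets (stopped_algebra M F T)" for A
    using filtration.sets_pre_sigmaD[OF filtration_extend T that[unfolded stopped_algebra_def], of \<infinity>]
    by (simp add: extend_filtration_def)
  then show ?thesis
    by (auto simp: subalgebra_def stopped_algebra_def filtration.space_pre_sigma[OF filtration_extend])
qed

lemma subalgebra_stopped_algebra_mono:
  assumes "stopping_time (extend_filtration M F) S" "stopping_time (extend_filtration M F) T"
    and "\<And>x. S x \<le> T x"
  shows "subalgebra (stopped_algebra M F T) (stopped_algebra M F S)"
  using filtration.mono_pre_sigma[OF filtration_extend assms(1,2)] assms(3)
  by (auto simp: subalgebra_def stopped_algebra_def filtration.space_pre_sigma[OF filtration_extend])

lemma measurable_stopping_time_count_space:
  assumes T: "stopping_time (extend_filtration M F) T"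
  shows "T \<in> measurable M (count_space UNIV)"
proof (subst measurable_count_space_eq2_countable, intro conjI ballI)
  fix t
  have "Measurable.pred (extend_filtration M F t) (\<lambda>x. T x = t)"
    by (rule filtration.stopping_time_eq_const[OF filtration_extend T])
  then have "{x \<in> space M. T x = t} \<in> sets M"
    using sets_extend_subset[of t] by (auto simp: pred_def space_extend)
  then show "T -` {t} \<inter> space M \<in> sets M"
    by (auto simp: vimage_def Int_def conj_commute)
qed auto

text \<open>Predictability: S < i means S \<le> i - 1, and i \<le> T is the complement of T \<le> i
  - 1, so both are decided one step before i. This is what makes conditioning on
  \<open>F (i - 1)\<close> usable without adaptedness of the summands.\<close>

lemma sets_stochastic_interval:
  assumes S: "stopping_time (extend_filtration M F) S"
    and T: "stopping_time (extend_filtration M F) T"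
    and A: "A \<in> sets (stopped_algebra M F S)" and i: "1 \<le> i"
  shows "{x \<in> A. S x < enat i \<and> enat i \<le> T x} \<in> sets (F (i - 1))"
proof -
  obtain n where n: "i = Suc n" using i by (cases i) auto
  have less: "t < enat i \<longleftrightarrow> t \<le> enat n" for t
    by (cases t) (auto simp: n)
  have "{x \<in> A. S x \<le> enat n} \<in> sets (F n)"
    using filtration.sets_pre_sigmaD[OF filtration_extend S A[unfolded stopped_algebra_def], of "enat n"]
    by (simp add: extend_filtration_def)
  moreover have "{x \<in> space M. T x \<le> enat n} \<in> sets (F n)"
    using stopping_timeD[OF T, of "enat n"] filtration.space_F[OF filtration_F]
    by (simp add: extend_filtration_def pred_def)
  moreover have "A \<subseteq> space M"
    using sets.sets_into_space[OF A] subalgebra_stopped_algebra[OF S] by (simp add: subalgebra_def)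
  then have "{x \<in> A. S x < enat i \<and> enat i \<le> T x}
      = {x \<in> A. S x \<le> enat n} - {x \<in> space M. T x \<le> enat n}"
    using less by (auto simp: not_le[symmetric])
  ultimately show ?thesis by (simp add: n)
qed

end

text \<open>No order between s and t is assumed: if s \<ge> t, including s = \<infinity>, the
  interval is empty and the truncated difference is 0.\<close>

lemma enat_interval:
  assumes "t < \<infinity>"
  shows "finite {i. s < enat i \<and> enat i \<le> t}" "card {i. s < enat i \<and> enat i \<le> t} = the_enat (t - s)"
proof -
  obtain b where t: "t = enat b" using assms by (cases t) auto
  have "{i. s < enat i \<and> enat i \<le> t} = (case s of enat a \<Rightarrow> {a<..b} | \<infinity> \<Rightarrow> {})"
    by (cases s) (auto simp: t)
  then show "finite {i. s < enat i \<and> enat i \<le> t}" "card {i. s < enat i \<and> enat i \<le> t} = the_enat (t - s)"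
    by (auto simp: t zero_enat_def split: enat.splits)
qed

text \<open>Stated for subsets \<open>J\<close> so that it covers both whole rounds and their
  truncations in dominated convergence. The condition s < i keeps index 0, where no bound is given,
  out of \<open>J\<close>.\<close>

lemma abs_sum_enat_interval_le:
  fixes y :: "nat \<Rightarrow> real"
  assumes "t < \<infinity>" and "\<And>i. i \<ge> 1 \<Longrightarrow> \<bar>y i\<bar> \<le> K" and J: "J \<subseteq> {i. s < enat i \<and> enat i \<le> t}"
  shows "\<bar>\<Sum>i\<in>J. y i\<bar> \<le> K * the_enat (t - s)"
proof -
  have K: "0 \<le> K" using assms(2)[of 1] by (simp add: order_trans[OF abs_ge_zero])
  have "i \<ge> 1" if "i \<in> J" for i
    using that J by (cases i) (auto simp: zero_enat_def[symmetric])
  then have "\<bar>\<Sum>i\<in>J. y i\<bar> \<le> card J * K"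
    using assms(2) by (intro order_trans[OF sum_abs] sum_bounded_above) auto
  also have "\<dots> \<le> the_enat (t - s) * K"
    using card_mono[OF enat_interval(1)[OF assms(1)] J] enat_interval(2)[OF assms(1), of s] K
    by (intro mult_right_mono) auto
  finally show ?thesis by (simp add: mult.commute)
qed

section \<open>Integrals of sums over stochastic intervals\<close>

context discrete_filtered_space
begin

text \<open>Each spin contributes the integral of \<open>Y i\<close> over an event of
  \<open>F (i - 1)\<close>, which is nonnegative by conditioning; dominated convergence then allows
  random interval lengths. \<open>U\<close> need only agree with the sum almost surely, which
  permits replacing the starting time by an almost surely equal one.\<close>

lemma integral_stochastic_interval_nonneg:
  fixes Y :: "nat \<Rightarrow> 'a \<Rightarrow> real"
  assumes S: "stopping_time (extend_filtration M F) S"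
    and T: "stopping_time (extend_filtration M F) T" and fin: "AE x in M. T x < \<infinity>"
    and A: "A \<in> sets (stopped_algebra M F S)"
    and Y: "\<And>i. i \<ge> 1 \<Longrightarrow> Y i \<in> borel_measurable M"
    and bound: "\<And>i. i \<ge> 1 \<Longrightarrow> AE x in M. \<bar>Y i x\<bar> \<le> K"
    and nonneg: "\<And>i. i \<ge> 1 \<Longrightarrow> AE x in M. 0 \<le> real_cond_exp M (F (i - 1)) (Y i) x"
    and len: "integrable M (\<lambda>x. real (the_enat (T x - S x)))"
    and U: "U \<in> borel_measurable M"
    and U_eq: "AE x in M. U x = (\<Sum>i | S x < enat i \<and> enat i \<le> T x. Y i x)"
  shows "0 \<le> (\<integral>x\<in>A. U x \<partial>M)"
proof -
  have [measurable]: "A \<in> sets M"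
    using A subalgebra_stopped_algebra[OF S] by (auto simp: subalgebra_def)
  have bound': "AE x in M. \<forall>i\<ge>1. \<bar>Y i x\<bar> \<le> K"
    using bound by (simp add: AE_all_countable)
  define E where "E i = {x \<in> A. S x < enat i \<and> enat i \<le> T x}" for i
  have E: "E i \<in> sets (F (i - 1))" if "i \<ge> 1" for i
    unfolding E_def using S T A that by (rule sets_stochastic_interval)
  then have EM: "E i \<in> sets M" if "i \<ge> 1" for i
    using that subalgebra_F[of "i - 1"] by (auto simp: subalgebra_def)
  \<comment> \<open>Truncation to spins up to n gives a finite sum that can be integrated term by
    term. Wherever T is finite, \<open>g n\<close> is constant from n = T on, and it is dominated by
    K times the length.\<close>
  define g where "g n x = (\<Sum>i=1..n. indicator (E i) x * Y i x)" for n x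
  have intY: "integrable M (Y i)" if "i \<ge> 1" for i
    using bound[OF that] Y[OF that] by (intro integrable_const_bound[where B = K]) auto
  have g_eq: "g n x = indicator A x * (\<Sum>i\<in>{1..n} \<inter> {i. S x < enat i \<and> enat i \<le> T x}. Y i x)" for n x
  proof -
    have "(\<Sum>i\<in>{1..n} \<inter> {i. S x < enat i \<and> enat i \<le> T x}. Y i x)
        = (\<Sum>i=1..n. if i \<in> {i. S x < enat i \<and> enat i \<le> T x} then Y i x else 0)"
      by (rule sum.inter_restrict) simp
    then show ?thesis
      unfolding g_def by (simp only: sum_distrib_left) (rule sum.cong, auto simp: E_def indicator_def)
  qed
  have "0 \<le> (\<integral>x. g n x \<partial>M)" for n
  proof -
    have "0 \<le> (\<integral>x. indicator (E i) x * Y i x \<partial>M)" if i: "i \<ge> 1" for i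
    proof -
      interpret s: sigma_finite_subalgebra M "F (i - 1)" by (rule sigma_finite_subalgebra_F)
      have "(\<integral>x. indicator (E i) x * Y i x \<partial>M)
          = (\<integral>x. indicator (E i) x * real_cond_exp M (F (i - 1)) (Y i) x \<partial>M)"
        using s.real_cond_exp_intA[OF intY[OF i] E[OF i]] by (simp add: set_lebesgue_integral_def)
      also have "\<dots> \<ge> 0"
        using nonneg[OF i] by (intro integral_nonneg_AE) (auto elim!: eventually_mono simp: indicator_def)
      finally show ?thesis .
    qed
    moreover have "(\<integral>x. g n x \<partial>M) = (\<Sum>i=1..n. \<integral>x. indicator (E i) x * Y i x \<partial>M)"
      unfolding g_def using integrable_mult_indicator[OF EM intY]
      by (intro Bochner_Integration.integral_sum) auto
    ultimately show ?thesis by (simp only:) (rule sum_nonneg, simp)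
  qed
  moreover have "(\<lambda>n. \<integral>x. g n x \<partial>M) \<longlonglongrightarrow> (\<integral>x. indicator A x * U x \<partial>M)"
  proof (rule integral_dominated_convergence)
    show "(\<lambda>x. indicator A x * U x) \<in> borel_measurable M" using U by measurable
    show "g n \<in> borel_measurable M" for n
      unfolding g_def using EM Y by (intro borel_measurable_sum borel_measurable_times borel_measurable_indicator) auto
    show "integrable M (\<lambda>x. K * real (the_enat (T x - S x)))" using len by simp
    show "AE x in M. (\<lambda>n. g n x) \<longlonglongrightarrow> indicator A x * U x"
      using fin U_eq
    proof eventually_elim
      case (elim x)
      obtain b where b: "T x = enat b" using elim(1) by (cases "T x") auto
      have "\<forall>\<^sub>F n in sequentially. g n x = indicator A x * U x"
        using eventually_ge_at_top[of b]
      proof eventually_elim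
        case (elim n)
        then have "{1..n} \<inter> {i. S x < enat i \<and> enat i \<le> T x} = {i. S x < enat i \<and> enat i \<le> T x}"
          using b by (auto simp: Suc_le_eq intro!: gr0I simp: zero_enat_def[symmetric])
        then show ?case unfolding g_eq using \<open>U x = _\<close> by simp
      qed
      then show ?case by (rule tendsto_eventually)
    qed
    show "AE x in M. norm (g n x) \<le> K * real (the_enat (T x - S x))" for n
      using fin bound'
    proof eventually_elim
      case (elim x)
      have "\<bar>\<Sum>i\<in>{1..n} \<inter> {i. S x < enat i \<and> enat i \<le> T x}. Y i x\<bar> \<le> K * the_enat (T x - S x)"
        using elim by (intro abs_sum_enat_interval_le) auto
      then show ?case unfolding g_eq by (auto simp: indicator_def)
    qed
  qed
  ultimately show ?thesis
    by (auto simp: set_lebesgue_integral_def intro: LIMSEQ_le_const)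
qed

end

text \<open>A maximum is taken because it preserves stopping times. Redefining \<tau> on the null
  set where it fails to increase might not, as the filtration is not assumed to contain null
  sets.\<close>

primrec running_max :: "(nat \<Rightarrow> 'a \<Rightarrow> enat) \<Rightarrow> nat \<Rightarrow> 'a \<Rightarrow> enat" where
  "running_max \<tau> 0 = \<tau> 0"
| "running_max \<tau> (Suc m) = (\<lambda>x. max (running_max \<tau> m x) (\<tau> (Suc m) x))"

lemma stopping_time_running_max:
  "(\<And>m. stopping_time G (\<tau> m)) \<Longrightarrow> stopping_time G (running_max \<tau> m)"
  by (induction m) (auto intro: stopping_time_max)

lemma running_max_mono: "m \<le> n \<Longrightarrow> running_max \<tau> m x \<le> running_max \<tau> n x"
  by (induction n rule: dec_induct) (auto intro: order_trans)

lemma le_running_max: "\<tau> m x \<le> running_max \<tau> m x"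
  by (cases m) auto

lemma running_max_eq:
  "(\<And>m. \<tau> m x < \<tau> (Suc m) x) \<Longrightarrow> running_max \<tau> m x = \<tau> m x"
  by (induction m) (auto simp: max_absorb2 less_imp_le)

lemma round_sum_diff:
  "round_sum \<tau> (\<lambda>i x. a * Y i x - b * Z i x) m x = a * round_sum \<tau> Y m x - b * round_sum \<tau> Z m x"
  by (simp add: round_sum_def sum_subtractf sum_distrib_left)

section \<open>Lower averages of round totals\<close>

context discrete_filtered_space
begin

text \<open>The times \<^term>\<open>\<tau> m\<close> increase only almost surely, so their stopped algebras need not be nested;
  those of the running maxima are, and they contain the former.\<close>

lemma round_sum_lower_average:
  fixes Y :: "nat \<Rightarrow> 'a \<Rightarrow> real"
  assumes \<tau>: "\<And>m. stopping_time (extend_filtration M F) (\<tau> m)"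
    and fin: "\<And>m. AE x in M. \<tau> m x < \<infinity>"
    and incr: "\<And>m. AE x in M. \<tau> m x < \<tau> (Suc m) x"
    and len: "(SUP m\<in>{1..}. \<integral>\<^sup>+ x. (ennreal_of_enat (\<tau> m x - \<tau> (m - 1) x))\<^sup>2 \<partial>M) < \<infinity>"
    and Y: "\<And>i. i \<ge> 1 \<Longrightarrow> Y i \<in> borel_measurable M"
    and bound: "\<And>i. i \<ge> 1 \<Longrightarrow> AE x in M. \<bar>Y i x\<bar> \<le> K"
    and nonneg: "\<And>i. i \<ge> 1 \<Longrightarrow> AE x in M. 0 \<le> real_cond_exp M (F (i - 1)) (Y i) x"
    and adapted: "\<And>m. m \<ge> 1 \<Longrightarrow> round_sum \<tau> Y m \<in> borel_measurable (stopped_algebra M F (\<tau> m))"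
  shows "AE x in M. \<forall>e>0. \<forall>\<^sub>F m in sequentially. - e * real m \<le> (\<Sum>j=1..m. round_sum \<tau> Y j x)"
proof -
  define S where "S = running_max \<tau>"
  define L where "L m x = real (the_enat (\<tau> m x - \<tau> (m - 1) x))" for m x
  have S: "stopping_time (extend_filtration M F) (S m)" for m
    unfolding S_def using \<tau> by (rule stopping_time_running_max)
  have [measurable]: "\<tau> m \<in> measurable M (count_space UNIV)" for m
    using \<tau> by (rule measurable_stopping_time_count_space)
  have L[measurable]: "L m \<in> borel_measurable M" for m
  proof -
    have "(\<lambda>x. (\<lambda>a x. real (the_enat (a - \<tau> (m - 1) x))) (\<tau> m x) x) \<in> borel_measurable M"
      by (rule measurable_compose_countable) measurable
    then show ?thesis unfolding L_def by simp
  qed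
  define Q where "Q = (SUP m\<in>{1..}. \<integral>\<^sup>+ x. (ennreal_of_enat (\<tau> m x - \<tau> (m - 1) x))\<^sup>2 \<partial>M)"
  have Q: "Q < \<infinity>" unfolding Q_def by (rule len)
  have L2: "integrable M (\<lambda>x. (L m x)\<^sup>2)" "(\<integral>x. (L m x)\<^sup>2 \<partial>M) \<le> enn2real Q" if m: "m \<ge> 1" for m
  proof -
    have "(\<integral>\<^sup>+ x. ennreal ((L m x)\<^sup>2) \<partial>M) = (\<integral>\<^sup>+ x. (ennreal_of_enat (\<tau> m x - \<tau> (m - 1) x))\<^sup>2 \<partial>M)"
    proof (rule nn_integral_cong_AE, use fin[of m] in eventually_elim)
      case (elim x)
      then obtain b where b: "\<tau> m x - \<tau> (m - 1) x = enat b"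
        by (cases "\<tau> m x"; cases "\<tau> (m - 1) x") (auto simp: zero_enat_def)
      then show ?case by (simp add: L_def ennreal_power[symmetric] ennreal_of_nat_eq_real_of_nat)
    qed
    also have "\<dots> \<le> Q" unfolding Q_def using m by (intro SUP_upper) auto
    finally have *: "(\<integral>\<^sup>+ x. ennreal ((L m x)\<^sup>2) \<partial>M) \<le> Q" .
    then have "(\<integral>\<^sup>+ x. ennreal ((L m x)\<^sup>2) \<partial>M) < \<infinity>"
      using Q by (rule order_le_less_trans)
    then show "integrable M (\<lambda>x. (L m x)\<^sup>2)"
      by (intro integrableI_nonneg) auto
    show "(\<integral>x. (L m x)\<^sup>2 \<partial>M) \<le> enn2real Q"
      using * Q by (subst integral_eq_nn_integral) (auto intro!: enn2real_mono)
  qed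
  have bound': "AE x in M. \<forall>i\<ge>1. \<bar>Y i x\<bar> \<le> K"
    using bound by (simp add: AE_all_countable)
  have W: "round_sum \<tau> Y m \<in> borel_measurable M" if "m \<ge> 1" for m
    using measurable_from_subalg[OF subalgebra_stopped_algebra[OF \<tau>] adapted[OF that]] .
  \<comment> \<open>The only place where the round length controls the second moment of a round
    total.\<close>
  have W_le: "AE x in M. (round_sum \<tau> Y m x)\<^sup>2 \<le> K\<^sup>2 * (L m x)\<^sup>2" if "m \<ge> 1" for m
    using fin[of m] bound'
  proof eventually_elim
    case (elim x)
    then have "\<bar>round_sum \<tau> Y m x\<bar> \<le> K * L m x"
      unfolding round_sum_def L_def by (intro abs_sum_enat_interval_le) auto
    then have "\<bar>round_sum \<tau> Y m x\<bar>\<^sup>2 \<le> (K * L m x)\<^sup>2"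
      by (rule power_mono) simp
    then show ?case by (simp add: power_mult_distrib)
  qed
  have S_eq: "AE x in M. \<forall>m. S m x = \<tau> m x"
  proof -
    have "AE x in M. \<forall>m. \<tau> m x < \<tau> (Suc m) x" using incr by (simp add: AE_all_countable)
    then show ?thesis by eventually_elim (simp add: S_def running_max_eq)
  qed
  show ?thesis
  proof (rule strong_law_conditionally_nonneg)
    show "prob_space M" by (rule prob_space_axioms)
    show "subalgebra M (stopped_algebra M F (S m))" for m
      using S by (rule subalgebra_stopped_algebra)
    show "subalgebra (stopped_algebra M F (S n)) (stopped_algebra M F (S m))" if "m \<le> n" for m n
      using S S running_max_mono[OF that] by (intro subalgebra_stopped_algebra_mono) (auto simp: S_def)
  next
    fix m :: nat assume m: "m \<ge> 1"
    show "round_sum \<tau> Y m \<in> borel_measurable (stopped_algebra M F (S m))"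
    proof (rule measurable_from_subalg[OF subalgebra_stopped_algebra_mono[OF \<tau> S] adapted[OF m]])
      show "\<tau> m x \<le> S m x" for x by (simp add: S_def le_running_max)
    qed
    have i: "integrable M (\<lambda>x. K\<^sup>2 * (L m x)\<^sup>2)" using L2(1)[OF m] by simp
    show iW: "integrable M (\<lambda>x. (round_sum \<tau> Y m x)\<^sup>2)"
      by (rule Bochner_Integration.integrable_bound[OF i]) (use W_le[OF m] W[OF m] in auto)
    have "(\<integral>x. (round_sum \<tau> Y m x)\<^sup>2 \<partial>M) \<le> (\<integral>x. K\<^sup>2 * (L m x)\<^sup>2 \<partial>M)"
      using iW i W_le[OF m] by (rule integral_mono_AE)
    also have "\<dots> \<le> K\<^sup>2 * enn2real Q"
      using L2(2)[OF m] by (simp add: mult_left_mono)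
    finally show "(\<integral>x. (round_sum \<tau> Y m x)\<^sup>2 \<partial>M) \<le> K\<^sup>2 * enn2real Q" .
    fix A assume A: "A \<in> sets (stopped_algebra M F (S (m - 1)))"
    show "0 \<le> (\<integral>x\<in>A. round_sum \<tau> Y m x \<partial>M)"
    \<comment> \<open>The interval starts at \<open>S (m - 1)\<close>, to which the test event
      \<open>A\<close> belongs, but ends at \<open>\<tau> m\<close>; almost surely it is the m-th
      round.\<close>
    proof (rule integral_stochastic_interval_nonneg[OF S \<tau> fin A Y bound nonneg _ W[OF m]])
      have "AE x in M. L m x = real (the_enat (\<tau> m x - S (m - 1) x))"
        using S_eq by eventually_elim (simp add: L_def)
      moreover have "integrable M (L m)"
        using L L2(1)[OF m] by (rule square_integrable_imp_integrable)
      moreover have "(\<lambda>x. real (the_enat (\<tau> m x - S (m - 1) x))) \<in> borel_measurable M"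
      proof -
        have [measurable]: "S (m - 1) \<in> measurable M (count_space UNIV)"
          using S by (rule measurable_stopping_time_count_space)
        have "(\<lambda>x. (\<lambda>a x. real (the_enat (a - S (m - 1) x))) (\<tau> m x) x) \<in> borel_measurable M"
          by (rule measurable_compose_countable) measurable
        then show ?thesis by simp
      qed
      ultimately show "integrable M (\<lambda>x. real (the_enat (\<tau> m x - S (m - 1) x)))"
        using L by (subst (asm) integrable_cong_AE) auto
      show "AE x in M. round_sum \<tau> Y m x = (\<Sum>i | S (m - 1) x < enat i \<and> enat i \<le> \<tau> m x. Y i x)"
        using S_eq by eventually_elim (simp add: round_sum_def)
    qed
  qed
qed

end

section \<open>Ratios of round totals\<close>

text \<open>Converts an error of order o(m) into one small relative to \<open>b m\<close>: with 0 <
  c below the lower limit, c m < b m eventually, so tolerance e c per round becomes e per unit of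
  \<open>b m\<close>.\<close>

lemma eventually_ge_neg_mult_of_average:
  fixes b d :: "nat \<Rightarrow> real"
  assumes "liminf (\<lambda>m. ereal (1 / real m * b m)) > 0"
    and d: "\<forall>e>0. \<forall>\<^sub>F m in sequentially. - e * real m \<le> d m" and e: "0 < e"
  shows "\<forall>\<^sub>F m in sequentially. 0 < b m \<and> - e * b m \<le> d m"
proof -
  obtain c where c: "0 < c" "ereal c < liminf (\<lambda>m. ereal (1 / real m * b m))"
    using ereal_dense2[OF assms(1)] by auto
  have "\<forall>\<^sub>F m in sequentially. - (e * c) * real m \<le> d m"
    using d c(1) e by simp
  then show ?thesis
    using less_LiminfD[OF c(2)] eventually_gt_at_top[of 0]
  proof eventually_elim
    case (elim m)
    then have "c * real m < b m" by (simp add: field_simps)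
    moreover from this have "e * (c * real m) \<le> e * b m" using e by simp
    moreover have "0 < c * real m" using elim(3) c(1) by simp
    ultimately show ?case using elim(1) by (simp add: mult.assoc)
  qed
qed

text \<open>Only indices with positive denominator matter in the limit, so the value given to a
  ratio with denominator 0 has no influence.\<close>

lemma ratio_lower_limit:
  fixes b y :: "nat \<Rightarrow> real"
  assumes "\<And>e. e > 0 \<Longrightarrow> \<forall>\<^sub>F m in sequentially. 0 < b m \<and> - e * b m \<le> y m - r * b m"
  shows "ereal r \<le> liminf (\<lambda>m. ereal (y m / b m))"
proof (rule ereal_le_epsilon2)
  fix e :: real assume e: "0 < e"
  have "ereal (r - e) \<le> liminf (\<lambda>m. ereal (y m / b m))"
    by (rule Liminf_bounded, use assms[OF e] in eventually_elim) (simp add: field_simps)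
  then show "ereal r \<le> liminf (\<lambda>m. ereal (y m / b m)) + ereal e"
    by (cases "liminf (\<lambda>m. ereal (y m / b m))") (auto simp: diff_le_eq)
qed

lemma ratio_upper_limit:
  fixes b y :: "nat \<Rightarrow> real"
  assumes "\<And>e. e > 0 \<Longrightarrow> \<forall>\<^sub>F m in sequentially. 0 < b m \<and> - e * b m \<le> r * b m - y m"
  shows "limsup (\<lambda>m. ereal (y m / b m)) \<le> ereal r"
proof (rule ereal_le_epsilon2)
  fix e :: real assume e: "0 < e"
  have "limsup (\<lambda>m. ereal (y m / b m)) \<le> ereal (r + e)"
    by (rule Limsup_bounded, use assms[OF e] in eventually_elim) (simp add: field_simps)
  then show "limsup (\<lambda>m. ereal (y m / b m)) \<le> ereal r + ereal e"
    by simp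
qed

context discrete_filtered_space
begin

lemma round_ratio_limits:
  fixes Y B :: "nat \<Rightarrow> 'a \<Rightarrow> real"
  assumes \<tau>: "\<And>m. stopping_time (extend_filtration M F) (\<tau> m)"
    and fin: "\<And>m. AE x in M. \<tau> m x < \<infinity>"
    and incr: "\<And>m. AE x in M. \<tau> m x < \<tau> (Suc m) x"
    and len: "(SUP m\<in>{1..}. \<integral>\<^sup>+ x. (ennreal_of_enat (\<tau> m x - \<tau> (m - 1) x))\<^sup>2 \<partial>M) < \<infinity>"
    and Y: "\<And>i. i \<ge> 1 \<Longrightarrow> Y i \<in> borel_measurable M" "\<And>i. i \<ge> 1 \<Longrightarrow> AE x in M. \<bar>Y i x\<bar> \<le> K"
    and B: "\<And>i. i \<ge> 1 \<Longrightarrow> B i \<in> borel_measurable M" "\<And>i. i \<ge> 1 \<Longrightarrow> AE x in M. 0 \<le> B i x \<and> B i x \<le> K"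
    and ratio: "cond_ratio_within M F lo hi Y B"
    and adapted: "\<And>m. m \<ge> 1 \<Longrightarrow> round_sum \<tau> Y m \<in> borel_measurable (stopped_algebra M F (\<tau> m))"
      "\<And>m. m \<ge> 1 \<Longrightarrow> round_sum \<tau> B m \<in> borel_measurable (stopped_algebra M F (\<tau> m))"
    and pos: "AE x in M. liminf (\<lambda>m. ereal (1 / real m * (\<Sum>j=1..m. round_sum \<tau> B j x))) > 0"
  shows "AE x in M. ereal lo \<le> liminf (\<lambda>m. ereal (round_ratio \<tau> Y B m x)) \<and>
    limsup (\<lambda>m. ereal (round_ratio \<tau> Y B m x)) \<le> ereal hi"
proof -
  have int: "integrable M (Y i)" "integrable M (B i)" if "i \<ge> 1" for i
    using Y(2)[OF that] Y(1)[OF that] B(2)[OF that] B(1)[OF that]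
    by (auto intro!: integrable_const_bound[where B = K])
  \<comment> \<open>The conditional expectation of the bet is nonnegative, so multiplying by it
    preserves both inequalities; in the 0/0 case they read 0 \<le> 0.\<close>
  have ce: "AE x in M. lo * real_cond_exp M (F (i - 1)) (B i) x \<le> real_cond_exp M (F (i - 1)) (Y i) x
      \<and> real_cond_exp M (F (i - 1)) (Y i) x \<le> hi * real_cond_exp M (F (i - 1)) (B i) x" if i: "i \<ge> 1" for i
  proof -
    interpret s: sigma_finite_subalgebra M "F (i - 1)" by (rule sigma_finite_subalgebra_F)
    have "AE x in M. 0 \<le> real_cond_exp M (F (i - 1)) (B i) x"
      using B[OF i] by (intro s.real_cond_exp_pos) auto
    moreover have "AE x in M. ratio_within lo hi (real_cond_exp M (F (i - 1)) (Y i) x)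
        (real_cond_exp M (F (i - 1)) (B i) x)"
      using ratio i by (simp add: cond_ratio_within_def)
    ultimately show ?thesis
      by eventually_elim (auto simp: ratio_within_def field_simps)
  qed
  \<comment> \<open>Used with (a, c) = (1, lo) for the lower bound and (-1, -hi) for the upper
    one.\<close>
  have average: "AE x in M. \<forall>e>0. \<forall>\<^sub>F m in sequentially.
      - e * real m \<le> (\<Sum>j=1..m. round_sum \<tau> (\<lambda>i x. a * Y i x - c * B i x) j x)"
    if nonneg: "\<And>i. i \<ge> 1 \<Longrightarrow> AE x in M. 0 \<le> a * real_cond_exp M (F (i - 1)) (Y i) x
      - c * real_cond_exp M (F (i - 1)) (B i) x" for a c
  proof (rule round_sum_lower_average[OF \<tau> fin incr len])
    fix i :: nat assume i: "i \<ge> 1"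
    show "(\<lambda>x. a * Y i x - c * B i x) \<in> borel_measurable M"
      using Y(1)[OF i] B(1)[OF i] by measurable
    show "AE x in M. \<bar>a * Y i x - c * B i x\<bar> \<le> \<bar>a\<bar> * K + \<bar>c\<bar> * K"
      using Y(2)[OF i] B(2)[OF i]
    proof eventually_elim
      case (elim x)
      then have "\<bar>a\<bar> * \<bar>Y i x\<bar> \<le> \<bar>a\<bar> * K" "\<bar>c\<bar> * \<bar>B i x\<bar> \<le> \<bar>c\<bar> * K"
        by (auto intro!: mult_left_mono)
      then show ?case
        using abs_triangle_ineq4[of "a * Y i x" "c * B i x"] unfolding abs_mult by linarith
    qed
    interpret s: sigma_finite_subalgebra M "F (i - 1)" by (rule sigma_finite_subalgebra_F)
    have "AE x in M. real_cond_exp M (F (i - 1)) (\<lambda>x. a * Y i x - c * B i x) x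
        = real_cond_exp M (F (i - 1)) (\<lambda>x. a * Y i x) x - real_cond_exp M (F (i - 1)) (\<lambda>x. c * B i x) x"
      using int[OF i] by (intro s.real_cond_exp_diff) auto
    then show "AE x in M. 0 \<le> real_cond_exp M (F (i - 1)) (\<lambda>x. a * Y i x - c * B i x) x"
      using s.real_cond_exp_cmult[OF int(1)[OF i], of a] s.real_cond_exp_cmult[OF int(2)[OF i], of c] nonneg[OF i]
      by eventually_elim simp
  next
    fix m :: nat assume m: "m \<ge> 1"
    have "(\<lambda>x. a * round_sum \<tau> Y m x - c * round_sum \<tau> B m x) \<in> borel_measurable (stopped_algebra M F (\<tau> m))"
      using adapted(1)[OF m] adapted(2)[OF m]
      by (intro borel_measurable_diff borel_measurable_times borel_measurable_const)
    then show "round_sum \<tau> (\<lambda>i x. a * Y i x - c * B i x) m \<in> borel_measurable (stopped_algebra M F (\<tau> m))"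
      by (subst measurable_cong[OF round_sum_diff])
  qed
  have "AE x in M. \<forall>e>0. \<forall>\<^sub>F m in sequentially.
      - e * real m \<le> (\<Sum>j=1..m. round_sum \<tau> (\<lambda>i x. 1 * Y i x - lo * B i x) j x)"
  proof (rule average)
    fix i :: nat assume "i \<ge> 1"
    from ce[OF this] show "AE x in M. 0 \<le> 1 * real_cond_exp M (F (i - 1)) (Y i) x
      - lo * real_cond_exp M (F (i - 1)) (B i) x" by eventually_elim simp
  qed
  moreover have "AE x in M. \<forall>e>0. \<forall>\<^sub>F m in sequentially.
      - e * real m \<le> (\<Sum>j=1..m. round_sum \<tau> (\<lambda>i x. - 1 * Y i x - - hi * B i x) j x)"
  proof (rule average)
    fix i :: nat assume "i \<ge> 1"
    from ce[OF this] show "AE x in M. 0 \<le> - 1 * real_cond_exp M (F (i - 1)) (Y i) x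
      - - hi * real_cond_exp M (F (i - 1)) (B i) x" by eventually_elim simp
  qed
  ultimately show ?thesis
    using pos
  proof eventually_elim
    case (elim x)
    let ?y = "\<lambda>m. \<Sum>j=1..m. round_sum \<tau> Y j x" and ?b = "\<lambda>m. \<Sum>j=1..m. round_sum \<tau> B j x"
    have sums: "(\<Sum>j=1..m. round_sum \<tau> (\<lambda>i x. 1 * Y i x - lo * B i x) j x) = ?y m - lo * ?b m"
      "(\<Sum>j=1..m. round_sum \<tau> (\<lambda>i x. - 1 * Y i x - - hi * B i x) j x) = hi * ?b m - ?y m" for m
      unfolding round_sum_diff by (simp_all add: sum_subtractf sum_distrib_left sum.distrib sum_negf)
    note ev = eventually_ge_neg_mult_of_average[OF elim(3)]
    show ?case
      unfolding round_ratio_def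
      using ev[OF elim(1)] ev[OF elim(2)] unfolding sums
      by (intro conjI ratio_lower_limit ratio_upper_limit) auto
  qed
qed

end

theorem theorem9p1:
  fixes M :: "'a measure"
    and F :: "nat \<Rightarrow> 'a measure"
    and \<tau> :: "nat \<Rightarrow> 'a \<Rightarrow> enat"
    and B R X :: "nat \<Rightarrow> 'a \<Rightarrow> real"
    and \<rho>' \<rho>'' \<chi>' \<chi>'' :: real
  assumes "prob_space M"
    and "filtration (space M) F"
    and "\<And>n. subalgebra M (F n)"
    and "\<And>m. stopping_time (extend_filtration M F) (\<tau> m)"
    and "\<And>m. AE \<omega> in M. \<tau> m \<omega> < \<infinity>"
    and "\<And>m. AE \<omega> in M. \<tau> m \<omega> < \<tau> (Suc m) \<omega>"
    and "AE \<omega> in M. \<tau> 0 \<omega> = 0"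
    and "(SUP m\<in>{1..}. \<integral>\<^sup>+ \<omega>. (ennreal_of_enat (\<tau> m \<omega> - \<tau> (m - 1) \<omega>))\<^sup>2 \<partial>M) < \<infinity>"
    and "\<And>n. n \<ge> 1 \<Longrightarrow> wager M (B n) (R n) (X n)"
    and "uniformly_bounded_wagers M B R X"
    and "\<chi>' = \<rho>' - 1" and "\<chi>'' = \<rho>'' - 1"
    and "\<And>m. m \<ge> 1 \<Longrightarrow> round_sum \<tau> B m \<in> borel_measurable (stopped_algebra M F (\<tau> m))"
    and "\<And>m. m \<ge> 1 \<Longrightarrow> round_sum \<tau> R m \<in> borel_measurable (stopped_algebra M F (\<tau> m))"
    and "\<And>m. m \<ge> 1 \<Longrightarrow> round_sum \<tau> X m \<in> borel_measurable (stopped_algebra M F (\<tau> m))"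
    and "AE \<omega> in M. liminf (\<lambda>m. ereal (1 / real m * (\<Sum>j=1..m. round_sum \<tau> B j \<omega>))) > 0"
  shows "(cond_ratio_within M F \<rho>' \<rho>'' R B \<longleftrightarrow> cond_ratio_within M F \<chi>' \<chi>'' X B) \<and>
    (cond_ratio_within M F \<rho>' \<rho>'' R B \<longrightarrow>
      (AE \<omega> in M. ereal \<rho>' \<le> liminf (\<lambda>m. ereal (round_ratio \<tau> R B m \<omega>)) \<and>
         liminf (\<lambda>m. ereal (round_ratio \<tau> R B m \<omega>)) \<le> limsup (\<lambda>m. ereal (round_ratio \<tau> R B m \<omega>)) \<and>
         limsup (\<lambda>m. ereal (round_ratio \<tau> R B m \<omega>)) \<le> ereal \<rho>'') \<and>
      (AE \<omega> in M. ereal \<chi>' \<le> liminf (\<lambda>m. ereal (round_ratio \<tau> X B m \<omega>)) \<and>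
         liminf (\<lambda>m. ereal (round_ratio \<tau> X B m \<omega>)) \<le> limsup (\<lambda>m. ereal (round_ratio \<tau> X B m \<omega>)) \<and>
         limsup (\<lambda>m. ereal (round_ratio \<tau> X B m \<omega>)) \<le> ereal \<chi>'') \<and>
      (\<forall>r c. c = r - 1 \<longrightarrow> (\<rho>' = r \<and> \<rho>'' = r) \<or> (\<chi>' = c \<and> \<chi>'' = c) \<longrightarrow>
         (AE \<omega> in M. (\<lambda>m. round_ratio \<tau> R B m \<omega>) \<longlonglongrightarrow> r) \<and>
         (AE \<omega> in M. (\<lambda>m. round_ratio \<tau> X B m \<omega>) \<longlonglongrightarrow> c)))"
proof -
  interpret discrete_filtered_space M F
    using assms(1-3) by (simp add: discrete_filtered_space_def discrete_filtered_space_axioms_def)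
  note \<tau> = assms(4) and fin = assms(5) and incr = assms(6) and len = assms(8) and wager = assms(9)
    and \<chi> = assms(11,12) and adapted = assms(13-15) and pos = assms(16)
  obtain C where C: "\<And>n. n \<ge> 1 \<Longrightarrow> AE x in M. B n x \<le> C \<and> R n x \<le> C \<and> \<bar>X n x\<bar> \<le> C"
    using assms(10) by (auto simp: uniformly_bounded_wagers_def)
  have meas: "B n \<in> borel_measurable M" "R n \<in> borel_measurable M" "X n \<in> borel_measurable M"
    if "n \<ge> 1" for n
    using wager[OF that] by (auto simp: wager_def)
  have wagerD: "AE x in M. B n x \<ge> 0 \<and> R n x \<ge> 0 \<and> X n x = R n x - B n x" if "n \<ge> 1" for n
    using wager[OF that] unfolding wager_def by (auto elim: eventually_mono)
  have B: "AE x in M. 0 \<le> B n x \<and> B n x \<le> C" and R: "AE x in M. \<bar>R n x\<bar> \<le> C"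
    and X: "AE x in M. \<bar>X n x\<bar> \<le> C" if "n \<ge> 1" for n
    using C[OF that] wagerD[OF that] by (eventually_elim, simp)+
  \<comment> \<open>By linearity the profit's conditional expectation is the return's minus the
    bet's: the ratio drops by 1 where the denominator is nonzero, and where it is 0 the two
    numerators coincide.\<close>
  have "AE x in M. ratio_within \<rho>' \<rho>'' (real_cond_exp M (F (n - 1)) (R n) x) (real_cond_exp M (F (n - 1)) (B n) x)
      \<longleftrightarrow> ratio_within \<chi>' \<chi>'' (real_cond_exp M (F (n - 1)) (X n) x) (real_cond_exp M (F (n - 1)) (B n) x)"
    if n: "n \<ge> 1" for n
  proof -
    interpret s: sigma_finite_subalgebra M "F (n - 1)" by (rule sigma_finite_subalgebra_F)
    have int: "integrable M (R n)" "integrable M (B n)"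
      using meas[OF n] R[OF n] B[OF n] by (auto intro!: integrable_const_bound[where B = C])
    have "AE x in M. real_cond_exp M (F (n - 1)) (X n) x = real_cond_exp M (F (n - 1)) (\<lambda>x. R n x - B n x) x"
      using wagerD[OF n] meas[OF n] by (intro s.real_cond_exp_cong) (auto elim: eventually_mono)
    then show ?thesis
      using s.real_cond_exp_diff[OF int]
      by eventually_elim (auto simp: ratio_within_def \<chi> diff_divide_distrib)
  qed
  note ratio_iff = this
  have equiv: "cond_ratio_within M F \<rho>' \<rho>'' R B \<longleftrightarrow> cond_ratio_within M F \<chi>' \<chi>'' X B"
  unfolding cond_ratio_within_def
  proof (intro iffI allI impI)
    fix n :: nat assume n: "n \<ge> 1"
    assume "\<forall>n\<ge>1. AE x in M. ratio_within \<rho>' \<rho>'' (real_cond_exp M (F (n - 1)) (R n) x)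
      (real_cond_exp M (F (n - 1)) (B n) x)"
    then have "AE x in M. ratio_within \<rho>' \<rho>'' (real_cond_exp M (F (n - 1)) (R n) x)
      (real_cond_exp M (F (n - 1)) (B n) x)"
      using n by blast
    then show "AE x in M. ratio_within \<chi>' \<chi>'' (real_cond_exp M (F (n - 1)) (X n) x)
      (real_cond_exp M (F (n - 1)) (B n) x)"
      using ratio_iff[OF n] by eventually_elim simp
  next
    fix n :: nat assume n: "n \<ge> 1"
    assume "\<forall>n\<ge>1. AE x in M. ratio_within \<chi>' \<chi>'' (real_cond_exp M (F (n - 1)) (X n) x)
      (real_cond_exp M (F (n - 1)) (B n) x)"
    then have "AE x in M. ratio_within \<chi>' \<chi>'' (real_cond_exp M (F (n - 1)) (X n) x)
      (real_cond_exp M (F (n - 1)) (B n) x)"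
      using n by blast
    then show "AE x in M. ratio_within \<rho>' \<rho>'' (real_cond_exp M (F (n - 1)) (R n) x)
      (real_cond_exp M (F (n - 1)) (B n) x)"
      using ratio_iff[OF n] by eventually_elim simp
  qed
  \<comment> \<open>The profit bounds come from the profit form of the hypothesis, obtained through
    \<open>equiv\<close>. Shifting the return ratios by 1 would break wherever the denominator
    vanishes.\<close>
  have main: "(AE \<omega> in M. ereal \<rho>' \<le> liminf (\<lambda>m. ereal (round_ratio \<tau> R B m \<omega>)) \<and>
         limsup (\<lambda>m. ereal (round_ratio \<tau> R B m \<omega>)) \<le> ereal \<rho>'')"
      "(AE \<omega> in M. ereal \<chi>' \<le> liminf (\<lambda>m. ereal (round_ratio \<tau> X B m \<omega>)) \<and>
         limsup (\<lambda>m. ereal (round_ratio \<tau> X B m \<omega>)) \<le> ereal \<chi>'')"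
    if "cond_ratio_within M F \<rho>' \<rho>'' R B"
    using that equiv
    by (intro round_ratio_limits[OF \<tau> fin incr len _ _ meas(1) B _ _ adapted(1) pos] meas R X adapted; simp)+
  have le: "liminf (\<lambda>m. ereal (f m)) \<le> limsup (\<lambda>m. ereal (f m))" for f :: "nat \<Rightarrow> real"
    by (intro Liminf_le_Limsup) simp
  show ?thesis
  proof (intro conjI impI allI equiv)
    assume cr: "cond_ratio_within M F \<rho>' \<rho>'' R B"
    show "AE \<omega> in M. ereal \<rho>' \<le> liminf (\<lambda>m. ereal (round_ratio \<tau> R B m \<omega>)) \<and>
         liminf (\<lambda>m. ereal (round_ratio \<tau> R B m \<omega>)) \<le> limsup (\<lambda>m. ereal (round_ratio \<tau> R B m \<omega>)) \<and>
         limsup (\<lambda>m. ereal (round_ratio \<tau> R B m \<omega>)) \<le> ereal \<rho>''"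
      using main(1)[OF cr] by eventually_elim (simp add: le)
    show "AE \<omega> in M. ereal \<chi>' \<le> liminf (\<lambda>m. ereal (round_ratio \<tau> X B m \<omega>)) \<and>
         liminf (\<lambda>m. ereal (round_ratio \<tau> X B m \<omega>)) \<le> limsup (\<lambda>m. ereal (round_ratio \<tau> X B m \<omega>)) \<and>
         limsup (\<lambda>m. ereal (round_ratio \<tau> X B m \<omega>)) \<le> ereal \<chi>''"
      using main(2)[OF cr] by eventually_elim (simp add: le)
    fix r c :: real assume "c = r - 1" "\<rho>' = r \<and> \<rho>'' = r \<or> \<chi>' = c \<and> \<chi>'' = c"
    then have eq: "\<rho>' = r" "\<rho>'' = r" "\<chi>' = c" "\<chi>'' = c" using \<chi> by auto
    show "AE \<omega> in M. (\<lambda>m. round_ratio \<tau> R B m \<omega>) \<longlonglongrightarrow> r"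
      using main(1)[OF cr] unfolding eq by eventually_elim (rule limsup_le_liminf_real, auto)
    show "AE \<omega> in M. (\<lambda>m. round_ratio \<tau> X B m \<omega>) \<longlonglongrightarrow> c"
      using main(2)[OF cr] unfolding eq by eventually_elim (rule limsup_le_liminf_real, auto)
  qed
qed

end
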